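(* Let $\mathcal{M}\subseteq\mathcal{B}$ be a (closed) invariant subspace of $\mathcal{L}$, and put $\Omega'=\{\frac{1}{\lambda}\colon \lambda\in\mathbb{C},\ \lambda\notin\sigma(\mathcal{M}_z)\}$. Then $$\sigma_{\mathrm{ap}}(\mathcal{L}|_{\mathcal{M}})\cap\Omega'=\sigma_{\mathrm{p}}(\mathcal{L}|_{\mathcal{M}})\cap\Omega'=\Big\{\tfrac{1}{\lambda}\colon \lambda\notin\sigma(\mathcal{M}_z)\text{ and there exists } h\in\ker\mathcal{L},\ h\neq0,\text{ such that }(\mathcal{M}_z-\lambda)^{-1}h\in\mathcal{M}\Big\}.$$
   Context: Notation: for a Banach space $\mathcal{X}$, $\boldsymbol{B}(\mathcal{X})$ is the Banach algebra of bounded linear operators on $\mathcal{X}$; $\sigma(T)$, $\sigma_{\mathrm{p}}(T)$, $\sigma_{\mathrm{ap}}(T)$ denote the spectrum, point spectrum and approximate point spectrum of $T$; $\ker T$ is the kernel. $\mathbb{N}$ is the set of positive integers. Setting. Let $\Omega\subset\mathbb{C}$ be a domain (nonempty connected open set), $E$ a complex Hilbert space, $n\in\mathbb{N}$, and $\mathcal{B}$ a complex Banach space of $E$-valued analytic functions on $\Omega$. Let $\mathcal{M}_z\in\boldsymbol{B}(\mathcal{B})$ be the operator of multiplication by the independent variable, $(\mathcal{M}_z f)(z)=zf(z)$, assumed to be left-invertible, and let $\mathcal{L}\in\boldsymbol{B}(\mathcal{B})$ be a left inverse of it, $\mathcal{L}\mathcal{M}_z=I$. Assume: (1) the inclusion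 map $\mathcal{B}\hookrightarrow \mathrm{Hol}(\Omega,E)$ is continuous, where $\mathrm{Hol}(\Omega,E)$ is the space of $E$-valued holomorphic functions on $\Omega$ with the topology of locally uniform convergence; (2) $\dim\ker\mathcal{L}=n$; (3) every $f\in\ker\mathcal{L}$ is analytic in (i.e. extends analytically to) an open neighborhood of $\overline{\Omega}$; (4) for every $f\in\mathcal{B}$ and every $\lambda\in\Omega$ there exist $g\in\mathcal{B}$ and $h\in\ker\mathcal{L}$ such that $f=(\mathcal{M}_z-\lambda)g+h$; (5) $\sigma(\mathcal{M}_z)=\overline{\Omega}$. *)

theory Defs
  imports "HOL-Analysis.Analysis"
begin

class complex_normed_vector = real_normed_vector +
  fixes scaleC :: "complex \<Rightarrow> 'a \<Rightarrow> 'a"  (infixr \<open>*\<^sub>C\<close> 75)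
  assumes scaleC_add_right: "a *\<^sub>C (x + y) = a *\<^sub>C x + a *\<^sub>C y"
    and scaleC_add_left: "(a + b) *\<^sub>C x = a *\<^sub>C x + b *\<^sub>C x"
    and scaleC_scaleC: "a *\<^sub>C b *\<^sub>C x = (a * b) *\<^sub>C x"
    and scaleC_one: "1 *\<^sub>C x = x"
    and scaleR_scaleC: "r *\<^sub>R x = complex_of_real r *\<^sub>C x"
    and norm_scaleC: "norm (a *\<^sub>C x) = cmod a * norm x"

class complex_banach = complex_normed_vector + complete_space

text \<open>The inner product is linear in its first argument.\<close>

class complex_hilbert = complex_banach +
  fixes cinner :: "'a \<Rightarrow> 'a \<Rightarrow> complex"
  assumes cinner_add_left: "cinner (x + y) z = cinner x z + cinner y z"
    and cinner_scaleC_left: "cinner (a *\<^sub>C x) y = a * cinner x y"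
    and cinner_commute: "cinner x y = cnj (cinner y x)"
    and cinner_norm: "cinner x x = complex_of_real ((norm x)\<^sup>2)"

global_interpretation complex_vector:
  vector_space "scaleC :: complex \<Rightarrow> 'a \<Rightarrow> 'a::complex_normed_vector"
  by unfold_locales
    (simp_all add: scaleC_add_right scaleC_add_left scaleC_scaleC scaleC_one)

definition bounded_clinear ::
    "('a::complex_normed_vector \<Rightarrow> 'b::complex_normed_vector) \<Rightarrow> bool" where
  "bounded_clinear T \<longleftrightarrow> bounded_linear T \<and> (\<forall>c x. T (c *\<^sub>C x) = c *\<^sub>C T x)"

definition ker :: "('a \<Rightarrow> 'b::zero) \<Rightarrow> 'a set" where
  "ker T = {x. T x = 0}"

definition shifted :: "('a::complex_normed_vector \<Rightarrow> 'a) \<Rightarrow> complex \<Rightarrow> 'a \<Rightarrow> 'a" where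
  "shifted T c = (\<lambda>x. T x - c *\<^sub>C x)"

definition op_spectrum :: "('a::complex_normed_vector \<Rightarrow> 'a) \<Rightarrow> complex set" where
  "op_spectrum T =
     {c. \<not> (\<exists>S. bounded_clinear S \<and> S \<circ> shifted T c = id \<and> shifted T c \<circ> S = id)}"

text \<open>In the next two definitions the operator is the restriction of \<open>T\<close> to a
  \<open>T\<close>-invariant subspace \<open>M\<close>.\<close>

definition point_spectrum_on ::
    "'a::complex_normed_vector set \<Rightarrow> ('a \<Rightarrow> 'a) \<Rightarrow> complex set" where
  "point_spectrum_on M T = {c. \<exists>x\<in>M. x \<noteq> 0 \<and> T x = c *\<^sub>C x}"

definition approx_point_spectrum_on ::
    "'a::complex_normed_vector set \<Rightarrow> ('a \<Rightarrow> 'a) \<Rightarrow> complex set" where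
  "approx_point_spectrum_on M T =
     {c. \<exists>x :: nat \<Rightarrow> 'a. (\<forall>k. x k \<in> M \<and> norm (x k) = 1) \<and>
           (\<lambda>k. shifted T c (x k)) \<longlonglongrightarrow> 0}"

definition vholomorphic_on ::
    "(complex \<Rightarrow> 'e::complex_normed_vector) \<Rightarrow> complex set \<Rightarrow> bool"
    (infixl \<open>vholomorphic'_on\<close> 50) where
  "f vholomorphic_on S \<longleftrightarrow>
     (\<forall>z\<in>S. \<exists>D. (f has_derivative (\<lambda>h. h *\<^sub>C D)) (at z within S))"

text \<open>A Banach space of \<open>E\<close>-valued analytic functions on \<open>\<Omega>\<close> is encoded as a Banach
  space \<open>'b\<close> together with an evaluation map \<open>ev\<close>: the vector \<open>f\<close> is the function
  \<open>z \<mapsto> ev f z\<close> on \<open>\<Omega>\<close>. Vector operations are pointwise and a vector is determined by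
  its values on \<open>\<Omega>\<close>; the values of \<open>ev f\<close> off \<open>\<Omega>\<close> are irrelevant.\<close>

definition analytic_function_space ::
    "complex set \<Rightarrow> ('b::complex_banach \<Rightarrow> complex \<Rightarrow> 'e::complex_normed_vector) \<Rightarrow> bool" where
  "analytic_function_space \<Omega> ev \<longleftrightarrow>
     (\<forall>f. ev f vholomorphic_on \<Omega>) \<and>
     (\<forall>f g. \<forall>z\<in>\<Omega>. ev (f + g) z = ev f z + ev g z) \<and>
     (\<forall>c f. \<forall>z\<in>\<Omega>. ev (c *\<^sub>C f) z = c *\<^sub>C ev f z) \<and>
     (\<forall>f g. (\<forall>z\<in>\<Omega>. ev f z = ev g z) \<longrightarrow> f = g)"

text \<open>Continuity, at every vector, of the inclusion into the holomorphic functions with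
  the topology of locally uniform convergence, i.e. (\<open>\<Omega>\<close> being open) of uniform
  convergence on compact subsets of \<open>\<Omega>\<close>.\<close>

definition continuous_inclusion ::
    "complex set \<Rightarrow> ('b::complex_banach \<Rightarrow> complex \<Rightarrow> 'e::complex_normed_vector) \<Rightarrow> bool" where
  "continuous_inclusion \<Omega> ev \<longleftrightarrow>
     (\<forall>f K. compact K \<and> K \<subseteq> \<Omega> \<longrightarrow> uniform_limit K ev (ev f) (nhds f))"

end

theory Submission
  imports Defs
begin

text \<open>An eigenvector \<open>x\<close> of \<open>L\<close> for the eigenvalue \<open>1 / c\<close> satisfies \<open>L ((Mz - c) x) = x - c L x = 0\<close>, so
  the eigenvectors are exactly the vectors \<open>(Mz - c)\<^sup>-\<^sup>1 h\<close> with \<open>0 \<noteq> h \<in> ker L\<close>. If instead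
  \<open>(L - 1 / c) x\<^sub>k \<rightarrow> 0\<close> with \<open>x\<^sub>k\<close> of norm one, then \<open>y\<^sub>k = (Mz - c) x\<^sub>k\<close> differs from its projection
  \<open>(1 - Mz L) y\<^sub>k\<close> to \<open>ker L\<close> by \<open>Mz (L y\<^sub>k) \<rightarrow> 0\<close>. As \<open>ker L\<close> is finite-dimensional, a subsequence of
  \<open>y\<^sub>k\<close> converges, and applying \<open>(Mz - c)\<^sup>-\<^sup>1\<close> yields an eigenvector in \<open>M\<close>.\<close>

section \<open>Compactness in finite-dimensional spans\<close>

lemma tendsto_scaleC_const:
  fixes a :: "'a::complex_normed_vector"
  assumes "(f \<longlongrightarrow> c) F"
  shows "((\<lambda>x. f x *\<^sub>C a) \<longlongrightarrow> c *\<^sub>C a) F"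
proof -
  have "norm (f x *\<^sub>C a - c *\<^sub>C a) = norm (f x - c) * norm a" for x
    by (metis complex_vector.scale_left_diff_distrib norm_scaleC)
  moreover have "((\<lambda>x. norm (f x - c) * norm a) \<longlongrightarrow> 0) F"
    using assms tendsto_mult_left_zero tendsto_norm_zero_iff Lim_null by blast
  ultimately show ?thesis
    by (subst Lim_null, subst tendsto_norm_zero_iff[symmetric]) simp
qed

text \<open>The induction provides closedness of the span of \<open>B\<close>, hence a positive distance from a new
  basis vector, which bounds the coefficients of that vector.\<close>

lemma bounded_seq_span_convergent_subseq:
  fixes B :: "'a::complex_normed_vector set"
  assumes "finite B" and "\<And>k. x k \<in> complex_vector.span B" and "bounded (range x)"
  shows "\<exists>l\<in>complex_vector.span B. \<exists>r::nat \<Rightarrow> nat. strict_mono r \<and> (x \<circ> r) \<longlonglongrightarrow> l"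
  using assms
proof (induction B arbitrary: x rule: finite_induct)
  case empty
  then have "(x \<circ> id) \<longlonglongrightarrow> 0" by (simp add: o_def)
  then show ?case using strict_mono_id by auto
next
  case (insert b B)
  let ?S = "complex_vector.span B"
  show ?case
  proof (cases "b \<in> ?S")
    case True
    then show ?thesis
      using insert by (simp add: complex_vector.span_redundant)
  next
    case False
    have "closed ?S"
      unfolding closed_sequential_limits
    proof (intro allI impI, elim conjE)
      fix y l assume y: "\<forall>n. y n \<in> ?S" and l: "y \<longlonglongrightarrow> l"
      obtain m and r :: "nat \<Rightarrow> nat" where "m \<in> ?S" "strict_mono r" "(y \<circ> r) \<longlonglongrightarrow> m"
        using insert.IH[of y] y convergent_imp_bounded[OF l] by blast
      then show "l \<in> ?S"
        using LIMSEQ_subseq_LIMSEQ[OF l] LIMSEQ_unique by blast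
    qed
    then obtain d where d: "d > 0" "ball b d \<subseteq> - ?S"
      using False by (metis ComplI openE open_Compl)
    \<comment> \<open>Factoring out \<open>a\<close> leaves the distance from \<open>b\<close> to
      \<open>-s / a\<close>, a point of the span and hence outside \<open>ball b d\<close>.\<close>
    have dist: "norm (a *\<^sub>C b + s) \<ge> cmod a * d" if "s \<in> ?S" for a s
    proof (cases "a = 0")
      case nz: False
      let ?t = "(- inverse a) *\<^sub>C s"
      have "?t \<in> ?S" using that complex_vector.span_scale by blast
      then have "d \<le> norm (b - ?t)"
        using d by (auto simp: dist_norm subset_iff not_less[symmetric])
      moreover have "a *\<^sub>C b + s = a *\<^sub>C (b - ?t)"
        using nz by (simp add: scaleC_add_right scaleC_scaleC complex_vector.scale_right_diff_distrib
            complex_vector.scale_minus_left scaleC_one)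
      ultimately show ?thesis
        by (simp add: norm_scaleC mult_left_mono)
    qed simp
    have "\<exists>a. x k - a *\<^sub>C b \<in> ?S" for k
      using insert.prems(1) by (simp add: complex_vector.span_breakdown_eq)
    then obtain a where a: "\<And>k. x k - a k *\<^sub>C b \<in> ?S" by metis
    define s where "s k = x k - a k *\<^sub>C b" for k
    obtain C where C: "\<And>k. norm (x k) \<le> C"
      using insert.prems(2) by (auto simp: bounded_iff)
    \<comment> \<open>Here \<open>dist\<close> is applied to the decomposition of \<open>x k\<close>
      itself, whose norm is at most \<open>C\<close>.\<close>
    have a_le: "cmod (a k) \<le> C / d" for k
      using dist[OF a[of k], of "a k"] C[of k] d(1) by (simp add: pos_le_divide_eq)
    then have "bounded (range a)" by (auto simp: bounded_iff)
    then obtain \<alpha> and r1 :: "nat \<Rightarrow> nat" where r1: "strict_mono r1" "(a \<circ> r1) \<longlonglongrightarrow> \<alpha>"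
      using bounded_imp_convergent_subsequence by blast
    have "norm (s k) \<le> C + C / d * norm b" for k
    proof -
      have "norm (s k) \<le> norm (x k) + cmod (a k) * norm b"
        unfolding s_def by (metis norm_scaleC norm_triangle_ineq4)
      also have "\<dots> \<le> C + C / d * norm b"
        using C a_le by (intro add_mono mult_right_mono) auto
      finally show ?thesis .
    qed
    then have "bounded (range (s \<circ> r1))" by (auto simp: bounded_iff)
    moreover have "(s \<circ> r1) k \<in> ?S" for k using a by (simp add: s_def)
    \<comment> \<open>The remainders are thinned out along \<open>r1\<close>, so that the
      coefficients still converge along the second subsequence.\<close>
    ultimately obtain l and r2 :: "nat \<Rightarrow> nat" where r2: "l \<in> ?S" "strict_mono r2"
        "(s \<circ> r1 \<circ> r2) \<longlonglongrightarrow> l"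
      using insert.IH[of "s \<circ> r1"] by blast
    have "(\<lambda>k. a (r1 (r2 k))) \<longlonglongrightarrow> \<alpha>"
      using LIMSEQ_subseq_LIMSEQ[OF r1(2) r2(2)] by (simp add: o_def)
    then have "(\<lambda>k. a (r1 (r2 k)) *\<^sub>C b + s (r1 (r2 k))) \<longlonglongrightarrow> \<alpha> *\<^sub>C b + l"
      using r2(3) by (intro tendsto_add tendsto_scaleC_const) (auto simp: o_def)
    then have "(x \<circ> (r1 \<circ> r2)) \<longlonglongrightarrow> \<alpha> *\<^sub>C b + l"
      by (simp add: s_def o_def)
    moreover have "\<alpha> *\<^sub>C b + l \<in> complex_vector.span (insert b B)"
      using r2(1) by (auto simp: complex_vector.span_breakdown_eq intro!: exI[of _ \<alpha>])
    ultimately show ?thesis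
      using r1(1) r2(2) strict_mono_o by blast
  qed
qed

section \<open>Eigenvalues and resolvents\<close>

lemma point_spectrum_on_subset_approx:
  assumes "complex_vector.subspace M" and "bounded_clinear T"
  shows "point_spectrum_on M T \<subseteq> approx_point_spectrum_on M T"
proof
  fix c assume "c \<in> point_spectrum_on M T"
  then obtain x where x: "x \<in> M" "x \<noteq> 0" "T x = c *\<^sub>C x" and T: "\<And>a x. T (a *\<^sub>C x) = a *\<^sub>C T x"
    using assms(2) by (auto simp: point_spectrum_on_def bounded_clinear_def)
  \<comment> \<open>The normalised eigenvector, repeated forever, serves as the approximating
    sequence.\<close>
  let ?u = "complex_of_real (inverse (norm x)) *\<^sub>C x"
  have "?u \<in> M" using assms(1) x(1) complex_vector.subspace_scale by blast
  moreover have "norm ?u = 1" using x(2) by (simp add: norm_scaleC norm_inverse)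
  moreover have "shifted T c ?u = 0"
    by (simp add: shifted_def T x(3) scaleC_scaleC mult.commute)
  ultimately show "c \<in> approx_point_spectrum_on M T"
    unfolding approx_point_spectrum_on_def by (auto intro!: exI[of _ "\<lambda>_. ?u"])
qed

text \<open>Uniqueness of two-sided inverses identifies the merely existing bounded inverse with
  \<open>inv\<close>, the form in which the resolvent enters the final statement.\<close>

lemma not_in_op_spectrumD:
  assumes "c \<notin> op_spectrum T"
  shows "bounded_clinear (inv (shifted T c))"
    and "inv (shifted T c) (shifted T c x) = x"
    and "shifted T c (inv (shifted T c) x) = x"
proof -
  obtain S where S: "bounded_clinear S" "S \<circ> shifted T c = id" "shifted T c \<circ> S = id"
    using assms by (auto simp: op_spectrum_def)
  have inv: "inv (shifted T c) = S" using S(3,2) by (rule inv_unique_comp)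
  show "bounded_clinear (inv (shifted T c))" using S(1) inv by simp
  show "inv (shifted T c) (shifted T c x) = x" "shifted T c (inv (shifted T c) x) = x"
    using S(2,3) inv by (simp_all add: fun_eq_iff)
qed

section \<open>Left-invertible operators\<close>

lemma zero_in_op_spectrum_left_invertible:
  assumes "L \<circ> T = id" and T0: "T 0 = 0" and "h \<in> ker L" and "h \<noteq> 0"
  shows "0 \<in> op_spectrum T"
proof (rule ccontr)
  assume nin: "0 \<notin> op_spectrum T"
  define S where "S = inv (shifted T 0)"
  have S: "T (S x) = x" for x
    using not_in_op_spectrumD(3)[OF nin, of x] by (simp add: S_def shifted_def)
  \<comment> \<open>A left inverse of an invertible operator is its inverse, so
    \<open>S h = L h = 0\<close>; applying \<open>T\<close> then forces
    \<open>h = 0\<close>.\<close>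
  have "S h = L (T (S h))" using fun_cong[OF assms(1), of "S h"] by simp
  also have "\<dots> = 0" using S assms(3) by (simp add: ker_def)
  finally show False
    using S[of h] T0 assms(4) by simp
qed

text \<open>Applying \<open>L\<close> to \<open>(T - c) x\<close> leaves \<open>x - c L x\<close>.
  This serves both for exact eigenvectors and for the limit of approximate ones.\<close>

lemma eigenvector_left_inverse_iff:
  assumes "bounded_clinear L" and "L \<circ> T = id" and "c \<noteq> 0"
  shows "L x = (1 / c) *\<^sub>C x \<longleftrightarrow> shifted T c x \<in> ker L"
proof -
  interpret L: bounded_linear L using assms by (simp add: bounded_clinear_def)
  have "L (shifted T c x) = x - c *\<^sub>C L x"
    using assms by (simp add: shifted_def L.diff bounded_clinear_def fun_eq_iff)
  moreover have "L x = (1 / c) *\<^sub>C x \<longleftrightarrow> x = c *\<^sub>C L x"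
    using assms(3) by (metis (no_types) divide_self mult.commute scaleC_one scaleC_scaleC
        times_divide_eq_left mult_1)
  ultimately show ?thesis by (simp add: ker_def)
qed

text \<open>Compactness is available only in \<open>ker L\<close>; the bounded resolvent of
  \<open>T\<close> at \<open>c\<close> carries it back to the unit vectors in
  \<open>M\<close>.\<close>

lemma approx_eigenvalue_left_inverse:
  fixes T L :: "'a::complex_normed_vector \<Rightarrow> 'a"
  assumes T: "bounded_clinear T" and L: "bounded_clinear L" and LT: "L \<circ> T = id"
    and B: "finite B" "ker L \<subseteq> complex_vector.span B"
    and c: "c \<noteq> 0" "c \<notin> op_spectrum T"
    and M: "closed M"
    and approx: "1 / c \<in> approx_point_spectrum_on M L"
  shows "1 / c \<in> point_spectrum_on M L"
proof -
  interpret T: bounded_linear T using T by (simp add: bounded_clinear_def)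
  interpret L: bounded_linear L using L by (simp add: bounded_clinear_def)
  have LT': "L (T x) = x" for x using LT by (simp add: fun_eq_iff)
  define S where "S = inv (shifted T c)"
  note S = not_in_op_spectrumD[OF c(2), folded S_def]
  interpret S: bounded_linear S using S(1) by (simp add: bounded_clinear_def)
  obtain x where x: "\<And>k. x k \<in> M" "\<And>k. norm (x k) = 1" "(\<lambda>k. shifted L (1 / c) (x k)) \<longlonglongrightarrow> 0"
    using approx by (auto simp: approx_point_spectrum_on_def)
  define y where "y k = shifted T c (x k)" for k
  define h where "h k = y k - T (L (y k))" for k
  \<comment> \<open>The operator identity is
    \<open>L (T - c) = 1 - c L = -c (L - 1 / c)\<close>.\<close>
  have "L (y k) = (- c) *\<^sub>C shifted L (1 / c) (x k)" for k
    using c(1) L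
    by (simp add: y_def shifted_def L.diff LT' bounded_clinear_def scaleC_scaleC scaleC_one
        complex_vector.scale_right_diff_distrib)
  then have "norm (L (y k)) = cmod c * norm (shifted L (1 / c) (x k))" for k
    by (simp only: norm_scaleC norm_minus_cancel)
  moreover have "(\<lambda>k. cmod c * norm (shifted L (1 / c) (x k))) \<longlonglongrightarrow> 0"
    using x(3) by (intro tendsto_mult_right_zero tendsto_norm_zero)
  ultimately have Ly: "(\<lambda>k. L (y k)) \<longlonglongrightarrow> 0"
    by (subst tendsto_norm_zero_iff[symmetric]) simp
  have TLy: "(\<lambda>k. T (L (y k))) \<longlonglongrightarrow> 0" using T.tendsto_zero[OF Ly] .
  have "norm (y k) \<le> onorm T + cmod c" for k
  proof -
    have "norm (y k) \<le> norm (T (x k)) + cmod c * norm (x k)"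
      unfolding y_def shifted_def by (metis norm_scaleC norm_triangle_ineq4)
    then show ?thesis
      using onorm[OF T.bounded_linear_axioms, of "x k"] x(2)[of k] by simp
  qed
  then have "bounded (range y)" by (auto simp: bounded_iff)
  then have "bounded (range h)"
    unfolding h_def using convergent_imp_bounded[OF TLy] by (rule bounded_minus_comp)
  \<comment> \<open>Since \<open>L T = 1\<close>, the operator \<open>1 - T L\<close> maps into
    \<open>ker L\<close>.\<close>
  moreover have "h k \<in> complex_vector.span B" for k
    using B(2) by (auto simp: ker_def h_def L.diff LT')
  ultimately obtain l and r :: "nat \<Rightarrow> nat" where r: "strict_mono r" "(h \<circ> r) \<longlonglongrightarrow> l"
    using bounded_seq_span_convergent_subseq[OF B(1), of h] by blast
  have "(\<lambda>k. h (r k) + T (L (y (r k)))) \<longlonglongrightarrow> l + 0"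
    using r(2) LIMSEQ_subseq_LIMSEQ[OF TLy r(1)] by (intro tendsto_add) (simp_all add: o_def)
  then have yr: "(\<lambda>k. y (r k)) \<longlonglongrightarrow> l" by (simp add: h_def)
  have "(\<lambda>k. S (y (r k))) \<longlonglongrightarrow> S l" using S.tendsto[OF yr] .
  then have xr: "(\<lambda>k. x (r k)) \<longlonglongrightarrow> S l" by (simp add: y_def S(2))
  have "S l \<in> M" by (rule closed_sequentially[OF M _ xr]) (rule x(1))
  \<comment> \<open>Norm convergence of unit vectors keeps the limit from vanishing.\<close>
  moreover have "norm (S l) = 1"
    using tendsto_norm[OF xr] by (simp add: x(2) LIMSEQ_const_iff)
  then have "S l \<noteq> 0" by auto
  moreover have "L (S l) = (1 / c) *\<^sub>C S l"
  proof -
    have "shifted T c (S l) = l" by (rule S(3))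
    moreover have "L l = 0"
      using L.tendsto[OF yr] LIMSEQ_subseq_LIMSEQ[OF Ly r(1), unfolded o_def] by (rule LIMSEQ_unique)
    ultimately show ?thesis
      by (simp add: eigenvector_left_inverse_iff[OF L LT c(1)] ker_def)
  qed
  ultimately show ?thesis by (auto simp: point_spectrum_on_def)
qed

theorem theorem2p2:
  fixes \<Omega> :: "complex set"
    and n :: nat
    and ev :: "'b::complex_banach \<Rightarrow> complex \<Rightarrow> 'e::complex_hilbert"
    and Mz L :: "'b \<Rightarrow> 'b"
    and M :: "'b set"
  assumes "open \<Omega>" and "connected \<Omega>" and "\<Omega> \<noteq> {}"
    and "n \<ge> 1"
    and "analytic_function_space \<Omega> ev"
    and "bounded_clinear Mz"
    and "\<And>f z. z \<in> \<Omega> \<Longrightarrow> ev (Mz f) z = z *\<^sub>C ev f z"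
    and "bounded_clinear L"
    and "L \<circ> Mz = id"
    and "continuous_inclusion \<Omega> ev"
    and "complex_vector.dim (ker L) = n"
    and "\<And>f. f \<in> ker L \<Longrightarrow>
           \<exists>U g. open U \<and> closure \<Omega> \<subseteq> U \<and> g vholomorphic_on U \<and> (\<forall>z\<in>\<Omega>. g z = ev f z)"
    and "\<And>f c. c \<in> \<Omega> \<Longrightarrow> \<exists>g. \<exists>h\<in>ker L. f = shifted Mz c g + h"
    and "op_spectrum Mz = closure \<Omega>"
    and "closed M" and "complex_vector.subspace M" and "L ` M \<subseteq> M"
  defines "\<Omega>' \<equiv> {1 / c | c. c \<notin> op_spectrum Mz}"
  shows "approx_point_spectrum_on M L \<inter> \<Omega>' = point_spectrum_on M L \<inter> \<Omega>' \<and>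
         point_spectrum_on M L \<inter> \<Omega>' =
           {1 / c | c. c \<notin> op_spectrum Mz \<and>
              (\<exists>h\<in>ker L. h \<noteq> 0 \<and> inv (shifted Mz c) h \<in> M)}"
proof -
  let ?E = "{1 / c | c. c \<notin> op_spectrum Mz \<and> (\<exists>h\<in>ker L. h \<noteq> 0 \<and> inv (shifted Mz c) h \<in> M)}"
  note Mz = \<open>bounded_clinear Mz\<close> and L = \<open>bounded_clinear L\<close> and LMz = \<open>L \<circ> Mz = id\<close>
  obtain B where B: "B \<subseteq> ker L" "complex_vector.independent B"
      "ker L \<subseteq> complex_vector.span B" "card B = n"
    using complex_vector.basis_exists[of "ker L"] \<open>complex_vector.dim (ker L) = n\<close> by metis
  \<comment> \<open>An infinite set has \<open>card\<close> 0, so a positive cardinality gives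
    finiteness as well as nonemptiness.\<close>
  with \<open>n \<ge> 1\<close> have finB: "finite B" and "B \<noteq> {}"
    using card_ge_0_finite[of B] by auto
  then obtain b where "b \<in> ker L" "b \<noteq> 0"
    using B(1,2) complex_vector.dependent_zero by blast
  moreover have Mz0: "Mz 0 = 0"
    using Mz linear_0 bounded_linear.linear unfolding bounded_clinear_def by blast
  ultimately have "0 \<in> op_spectrum Mz"
    using zero_in_op_spectrum_left_invertible[OF LMz] by blast
  \<comment> \<open>This excludes the junk value \<open>1 / 0 = 0\<close> from \<open>\<Omega>'\<close>; it is where \<open>n \<ge> 1\<close> matters.\<close>
  then have nz: "c \<noteq> 0" if "c \<notin> op_spectrum Mz" for c
    using that by blast
  have eq: "1 / c \<in> point_spectrum_on M L \<longleftrightarrow> (\<exists>h\<in>ker L. h \<noteq> 0 \<and> inv (shifted Mz c) h \<in> M)"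
    if c: "c \<notin> op_spectrum Mz" for c
  proof -
    let ?S = "inv (shifted Mz c)"
    note S = not_in_op_spectrumD(2,3)[OF c]
    have eig: "L x = (1 / c) *\<^sub>C x \<longleftrightarrow> shifted Mz c x \<in> ker L" for x
      using eigenvector_left_inverse_iff[OF L LMz nz[OF c]] .
    have shifted0: "shifted Mz c 0 = 0" by (simp add: shifted_def Mz0)
    show ?thesis
    proof
      assume "1 / c \<in> point_spectrum_on M L"
      then obtain x where x: "x \<in> M" "x \<noteq> 0" "shifted Mz c x \<in> ker L"
        by (auto simp: point_spectrum_on_def eig)
      \<comment> \<open>The witness is \<open>h = (Mz - c) x\<close>; it is nonzero by injectivity,
        and \<open>?S\<close> returns it to \<open>x\<close>.\<close>
      moreover have "shifted Mz c x \<noteq> 0"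
        using x(2) S(1)[of x] S(1)[of 0] shifted0 by metis
      ultimately show "\<exists>h\<in>ker L. h \<noteq> 0 \<and> ?S h \<in> M"
        using S(1) by (intro bexI[of _ "shifted Mz c x"]) simp_all
    next
      assume "\<exists>h\<in>ker L. h \<noteq> 0 \<and> ?S h \<in> M"
      then obtain h where h: "h \<in> ker L" "h \<noteq> 0" "?S h \<in> M" by blast
      then have "?S h \<noteq> 0" using S(2)[of h] shifted0 by metis
      moreover have "L (?S h) = (1 / c) *\<^sub>C ?S h" using h(1) S(2) eig by simp
      ultimately show "1 / c \<in> point_spectrum_on M L"
        using h(3) by (auto simp: point_spectrum_on_def)
    qed
  qed
  have "approx_point_spectrum_on M L \<inter> \<Omega>' \<subseteq> point_spectrum_on M L"
  proof
    fix z assume z: "z \<in> approx_point_spectrum_on M L \<inter> \<Omega>'"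
    then obtain c where c: "z = 1 / c" "c \<notin> op_spectrum Mz"
      by (auto simp: \<Omega>'_def)
    show "z \<in> point_spectrum_on M L"
      using approx_eigenvalue_left_inverse[OF Mz L LMz finB B(3) nz[OF c(2)] c(2) \<open>closed M\<close>] z c(1)
      by simp
  qed
  then have "approx_point_spectrum_on M L \<inter> \<Omega>' = point_spectrum_on M L \<inter> \<Omega>'"
    using point_spectrum_on_subset_approx[OF \<open>complex_vector.subspace M\<close> L] by blast
  moreover have "point_spectrum_on M L \<inter> \<Omega>' = ?E"
  proof
    show "point_spectrum_on M L \<inter> \<Omega>' \<subseteq> ?E"
      using eq by (fastforce simp: \<Omega>'_def)
    show "?E \<subseteq> point_spectrum_on M L \<inter> \<Omega>'"
      using eq by (fastforce simp: \<Omega>'_def)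
  qed
  ultimately show ?thesis by (rule conjI)
qed

end
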